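(* Let $m\ge1$, $n=2m$, and let $L(x)=\sum_{i=0}^k\alpha_ix^{2^{a_i}}\in \mathbb{F}_{2^m}[x]$ be a linearized polynomial with coefficients $\alpha_i\in\mathbb{F}_{2^m}$ and nonnegative integers $a_i$. Define $$r(L)=\sum_{a\in \mathbb{F}_{2^n}}\chi_n\big((a^{2^m}+a)L(a)\big).$$ Then $$r(L)=2^m\sum_{u\in \mathbb{F}_{2^m}}\chi_m(uL(u))=2^m\sum_{u\in \mathbb{F}_{2^m}}\chi_m\left(\sum_{i=0}^k\alpha_iu^{2^{a_i}+1}\right).$$
   Context: For a positive integer $t$, ${\rm Tr}_1^t(x)=\sum_{i=0}^{t-1}x^{2^i}$ is the absolute trace from $\mathbb{F}_{2^t}$ to $\mathbb{F}_2$ and $\chi_t(x)=(-1)^{{\rm Tr}_1^t(x)}$. $\mathbb{F}_{2^m}$ is regarded as the subfield of $\mathbb{F}_{2^n}$. *)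

theory Defs
  imports "HOL-Algebra.Algebraic_Closure_Type"
begin

(* The trace of F_(2^t), computed in any field that contains F_(2^t). Its values 0 and 1 are
   elements of that field. *)
definition abs_trace :: "nat \<Rightarrow> 'a::field \<Rightarrow> 'a" where
  "abs_trace t x = (\<Sum>i<t. x ^ (2 ^ i))"

lemma abs_trace_in_prime_field:
  fixes x :: "'a::field"
  assumes "CHAR('a) = 2" and "x ^ (2 ^ t) = x"
  shows "abs_trace t x \<in> {0, 1}"
proof -
  have "abs_trace t x ^ 2 = (\<Sum>i<t. (x ^ (2 ^ i)) ^ 2)"
    unfolding abs_trace_def
    by (rule freshmans_dream_sum) (simp_all only: assms(1) two_is_prime_nat)
  also have "\<dots> = (\<Sum>i<t. x ^ (2 ^ Suc i))"
    by (rule sum.cong) (simp_all only: power_Suc2 power_mult)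
  also have "\<dots> = abs_trace t x + (x ^ (2 ^ t) - x)"
    unfolding abs_trace_def by (induction t) simp_all
  finally have "abs_trace t x * (abs_trace t x - 1) = 0"
    using assms(2) by (simp add: power2_eq_square algebra_simps)
  then show ?thesis by auto
qed

(* (-1) raised to the trace: the inner conditional lifts the trace value from {0, 1} in the
   field to the natural numbers. Meaningful for x in F_(2^t), by the lemma above. *)
definition chi :: "nat \<Rightarrow> 'a::field \<Rightarrow> int" where
  "chi t x = (- 1) ^ (if abs_trace t x = 0 then 0 else 1)"

definition linearized_poly :: "nat \<Rightarrow> (nat \<Rightarrow> 'a::field) \<Rightarrow> (nat \<Rightarrow> nat) \<Rightarrow> 'a poly" where
  "linearized_poly k \<alpha> a = (\<Sum>i=0..k. Polynomial.monom (\<alpha> i) (2 ^ a i))"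

(* The ambient type 'a plays the role of F_(2^n) with n = 2 m. *)
definition r_sum :: "nat \<Rightarrow> 'a::field poly \<Rightarrow> int" where
  "r_sum m L = (\<Sum>a\<in>UNIV. chi (2 * m) ((a ^ (2 ^ m) + a) * poly L a))"

end

theory Submission
  imports Defs
begin

text \<open>Write q = 2^m and T(a) = a^q + a. Since the coefficients of L lie in the subfield of order q,
  T(a) L(a) plus its q-th power equals T(a) L(T(a)), so transitivity of the trace turns the n-th
  character at T(a) L(a) into the m-th character at T(a) L(T(a)). The additive map T has the
  subfield of order q as kernel and hence also as image, so it takes every value there exactly
  q times.\<close>

text \<open>Translation by 1 permutes the field, so summing all elements before and after it shows
  that the cardinality \<open>2 ^ n\<close> vanishes in the field.\<close>

lemma CHAR_eq_2_if_card_power_2: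
  assumes "card (UNIV :: 'a::field set) = 2 ^ n"
  shows "CHAR('a) = 2"
proof -
  have "(\<Sum>x\<in>(UNIV::'a set). x) = (\<Sum>x\<in>(UNIV::'a set). x + 1)"
    by (rule sum.reindex_bij_witness[of _ "\<lambda>x. x + 1" "\<lambda>x. x - 1"]) auto
  also have "\<dots> = (\<Sum>x\<in>(UNIV::'a set). x) + of_nat (card (UNIV :: 'a set))"
    by (simp add: sum.distrib)
  finally have "(of_nat 2 :: 'a) ^ n = 0"
    using assms by simp
  then have "(of_nat 2 :: 'a) = 0"
    by simp
  then have "CHAR('a) dvd 2"
    by (simp only: of_nat_eq_0_iff_char_dvd)
  then show ?thesis
    using CHAR_not_1' two_is_prime_nat unfolding prime_nat_iff by (metis One_nat_def)
qed

lemma freshmans_dream_2_power: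
  fixes x y :: "'a::field"
  assumes "CHAR('a) = 2"
  shows "(x + y) ^ (2 ^ i) = x ^ (2 ^ i) + y ^ (2 ^ i)"
  by (rule freshmans_dream') (simp_all add: assms)

lemma freshmans_dream_sum_2_power:
  fixes f :: "'b \<Rightarrow> 'a::field"
  assumes "CHAR('a) = 2"
  shows "sum f A ^ (2 ^ i) = (\<Sum>x\<in>A. f x ^ (2 ^ i))"
  by (rule freshmans_dream_sum') (simp_all add: assms)

text \<open>Multiplication by a nonzero \<open>x\<close> permutes the nonzero elements of
  \<open>K\<close>; comparing their products gives exponent \<open>card K - 1\<close>. Asking only
  for closure under products lets the lemma serve both the subfield and the whole type.\<close>

lemma power_card_eq_self:
  fixes K :: "'a::field set"
  assumes "finite K" and mult: "\<And>x y. x \<in> K \<Longrightarrow> y \<in> K \<Longrightarrow> x * y \<in> K"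
    and "0 \<in> K" and "x \<in> K"
  shows "x ^ card K = x"
proof (cases "x = 0")
  case True
  \<comment> \<open>A positive exponent is essential, as \<open>0 ^ 0 = 1\<close>.\<close>
  have "card K > 0" using assms(1,3) card_gt_0_iff by blast
  with True show ?thesis by simp
next
  case False
  let ?K = "K - {0}"
  have inj: "inj_on ((*) x) ?K"
    using False by (auto intro: inj_onI)
  have "(*) x ` ?K = ?K"
    using assms(1,4) mult False inj by (intro endo_inj_surj) auto
  then have "\<Prod>?K = (\<Prod>y\<in>?K. x * y)"
    using prod.reindex[OF inj, of "\<lambda>y. y"] by simp
  also have "\<dots> = x ^ card ?K * \<Prod>?K"
    by (simp add: prod.distrib)
  finally have "x ^ card ?K = 1"
    using assms(1) by simp
  moreover have "card K = Suc (card ?K)"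
    using assms(1,3) by (rule card.remove)
  ultimately show ?thesis by simp
qed

text \<open>The \<open>q\<close> elements of \<open>K\<close> are roots of X^q - X, which has at
  most \<open>q\<close> roots, so they are all of them.\<close>

lemma subfield_eq_power_card_fixed_points:
  fixes K :: "'a::field set"
  assumes "subfield K (ring_of_type_algebra :: 'a ring)" and "card K = q" and "q > 1"
  shows "K = {x. x ^ q = x}"
proof -
  interpret subfield K "ring_of_type_algebra :: 'a ring" by fact
  have "finite K" using assms card_ge_0_finite by force
  have mult: "x * y \<in> K" if "x \<in> K" "y \<in> K" for x y
    using m_closed[OF that] by (simp add: ring_of_type_algebra_def)
  have zero: "0 \<in> K"
    using subringE(2)[OF subfieldE(1)[OF assms(1)]] by (simp add: ring_of_type_algebra_def)
  have sub: "K \<subseteq> {x. x ^ q = x}"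
    using power_card_eq_self[OF \<open>finite K\<close> mult zero] assms(2) by auto
  let ?p = "Polynomial.monom 1 q - Polynomial.monom 1 1 :: 'a poly"
  have "poly.coeff ?p q = 1" using assms(3) by (simp add: coeff_monom)
  then have nz: "?p \<noteq> 0" by (metis coeff_0 zero_neq_one)
  have "Polynomial.degree ?p \<le> q"
    using assms(3) by (intro degree_diff_le order.trans[OF degree_monom_le]) auto
  moreover have "{x. poly ?p x = 0} = {x. x ^ q = x}"
    by (simp add: poly_monom)
  ultimately have "card {x::'a. x ^ q = x} \<le> card K" "finite {x::'a. x ^ q = x}"
    using card_poly_roots_bound[OF nz] poly_roots_finite[OF nz] assms(2) by auto
  then show ?thesis
    using sub card_seteq by metis
qed

text \<open>Transitivity of the trace: the upper half of the Frobenius powers of \<open>x\<close> is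
  the lower half for \<open>x ^ (2 ^ m)\<close>.\<close>

lemma abs_trace_double:
  fixes x :: "'a::field"
  assumes "CHAR('a) = 2"
  shows "abs_trace (2 * m) x = abs_trace m (x ^ (2 ^ m) + x)"
proof -
  \<comment> \<open>The length \<open>k\<close> is kept free for the induction; the case
    \<open>k = m\<close> is the one used.\<close>
  have split: "(\<Sum>i<m + k. x ^ (2 ^ i)) = (\<Sum>i<m. x ^ (2 ^ i)) + (\<Sum>i<k. x ^ (2 ^ (m + i)))" for k
    by (induction k) (simp_all add: add.assoc)
  show ?thesis
    unfolding abs_trace_def mult_2 split power_add power_mult
    by (simp only: freshmans_dream_2_power[OF assms] sum.distrib add.commute)
qed

lemma poly_linearized_poly:
  "poly (linearized_poly k \<alpha> a) x = (\<Sum>i=0..k. \<alpha> i * x ^ (2 ^ a i))"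
  by (simp add: linearized_poly_def poly_sum poly_monom)

text \<open>Every nonempty fibre of an additive map is a translate of its kernel.\<close>

lemma sum_comp_additive:
  fixes T :: "'a::ab_group_add \<Rightarrow> 'b::ab_group_add" and g :: "'b \<Rightarrow> 'c::comm_semiring_1"
  assumes "finite (UNIV :: 'a set)" and add: "\<And>x y. T (x + y) = T x + T y"
  shows "(\<Sum>x\<in>UNIV. g (T x)) = of_nat (card {x. T x = 0}) * (\<Sum>u\<in>range T. g u)"
proof -
  have fibre: "card {x. T x = T b} = card {x. T x = 0}" for b
  proof (rule bij_betw_same_card)
    have "T (x - b) = T x - T b" for x
      using add[of "x - b" b] by simp
    then show "bij_betw (\<lambda>x. x - b) {x. T x = T b} {x. T x = 0}"
      by (intro bij_betwI[where g = "\<lambda>x. x + b"]) (auto simp: add)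
  qed
  have "(\<Sum>x\<in>UNIV. g (T x)) = (\<Sum>u\<in>range T. \<Sum>x\<in>{x. T x = u}. g (T x))"
    using sum.image_gen[OF assms(1), of "\<lambda>x. g (T x)" T] by simp
  also have "\<dots> = (\<Sum>u\<in>range T. of_nat (card {x. T x = 0}) * g u)"
    by (rule sum.cong) (auto simp: fibre)
  finally show ?thesis by (simp add: sum_distrib_left)
qed

lemma chi_double_linearized:
  fixes x :: "'a::field"
  assumes char: "CHAR('a) = 2" and x: "x ^ (2 ^ (2 * m)) = x"
    and \<alpha>: "\<And>i. i \<le> k \<Longrightarrow> \<alpha> i ^ (2 ^ m) = \<alpha> i"
    and L: "L = linearized_poly k \<alpha> a" and u: "u = x ^ (2 ^ m) + x"
  shows "chi (2 * m) (u * poly L x) = chi m (u * poly L u)"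
proof -
  have xx: "(x ^ (2 ^ m)) ^ (2 ^ m) = x"
    using x by (simp add: mult_2 power_add power_mult)
  have uu: "u ^ (2 ^ m) = u"
    unfolding u by (simp add: freshmans_dream_2_power[OF char] xx add.commute)
  \<comment> \<open>The \<open>2 ^ m\<close>-th power map is additive and fixes the coefficients,
    hence commutes with \<open>L\<close>.\<close>
  have "poly L x ^ (2 ^ m) = (\<Sum>i=0..k. (\<alpha> i * x ^ (2 ^ a i)) ^ (2 ^ m))"
    by (simp only: L poly_linearized_poly freshmans_dream_sum_2_power[OF char])
  also have "\<dots> = poly L (x ^ (2 ^ m))"
    unfolding L poly_linearized_poly
    by (rule sum.cong) (simp_all add: power_mult_distrib \<alpha> mult.commute flip: power_mult)
  finally have "poly L x ^ (2 ^ m) + poly L x = poly L u"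
    by (simp add: L poly_linearized_poly u freshmans_dream_2_power[OF char]
        distrib_left sum.distrib)
  then have "(u * poly L x) ^ (2 ^ m) + u * poly L x = u * poly L u"
    by (simp add: power_mult_distrib uu flip: distrib_left)
  then show ?thesis
    by (simp add: chi_def abs_trace_double[OF char])
qed

theorem theorem3:
  fixes m n k :: nat
    and K :: "'a::field set"
    and \<alpha> :: "nat \<Rightarrow> 'a"
    and a :: "nat \<Rightarrow> nat"
    and L :: "'a poly"
  assumes "m \<ge> 1" and "n = 2 * m"
    and "card (UNIV :: 'a set) = 2 ^ n"
    and "subfield K (ring_of_type_algebra :: 'a ring)" and "card K = 2 ^ m"
    and "\<And>i. i \<le> k \<Longrightarrow> \<alpha> i \<in> K"
    and "L = linearized_poly k \<alpha> a"
  shows "r_sum m L = 2 ^ m * (\<Sum>u\<in>K. chi m (u * poly L u))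
    \<and> 2 ^ m * (\<Sum>u\<in>K. chi m (u * poly L u))
      = 2 ^ m * (\<Sum>u\<in>K. chi m (\<Sum>i=0..k. \<alpha> i * u ^ (2 ^ a i + 1)))"
proof
  have char: "CHAR('a) = 2"
    using assms(3) by (rule CHAR_eq_2_if_card_power_2)
  \<comment> \<open>An infinite type would have \<open>card\<close> equal to 0, which is no power of
    2.\<close>
  have fin: "finite (UNIV :: 'a set)"
    using assms(3) by (metis card.infinite power_not_zero zero_neq_numeral)
  have K: "K = {x. x ^ (2 ^ m) = x}"
    using assms(1) by (intro subfield_eq_power_card_fixed_points assms(4,5) one_less_power) auto
  have x: "x ^ (2 ^ (2 * m)) = x" for x :: 'a
    using power_card_eq_self[OF fin, of x] assms(2,3) by simp
  define T where "T = (\<lambda>x::'a. x ^ (2 ^ m) + x)"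
  have T_add: "T (x + y) = T x + T y" for x y
    by (simp add: T_def freshmans_dream_2_power[OF char])
  \<comment> \<open>In characteristic 2 the kernel of \<open>T\<close> is thus the set of fixed
    points of the \<open>2 ^ m\<close>-th power map, which is \<open>K\<close>.\<close>
  have "x + y = 0 \<longleftrightarrow> x = y" for x y :: 'a
    using uminus_CHAR_2[OF char, of y] by (metis add_eq_0_iff2)
  then have ker: "{x. T x = 0} = K"
    by (simp add: T_def K)
  have "range T \<subseteq> K"
    using x by (auto simp: T_def K freshmans_dream_2_power[OF char] add.commute
        mult_2 power_add power_mult)
  \<comment> \<open>Summing the constant 1 counts the field: \<open>2 ^ (2 * m)\<close> is
    \<open>2 ^ m\<close> times the size of the range, so \<open>T\<close> maps onto
    \<open>K\<close>.\<close>
  moreover have "card (range T) = card K"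
    using sum_comp_additive[OF fin T_add, of "\<lambda>_. 1 :: nat"] assms(2,3,5)
    by (simp add: ker mult_2 power_add)
  moreover have "finite K" using fin by (rule rev_finite_subset) simp
  ultimately have range: "range T = K"
    using card_subset_eq by blast
  have "r_sum m L = (\<Sum>x\<in>UNIV. chi m (T x * poly L (T x)))"
    unfolding r_sum_def T_def
    using assms(6) K
    by (intro sum.cong refl chi_double_linearized[OF char x _ assms(7)]) auto
  also have "\<dots> = of_nat (card K) * (\<Sum>u\<in>K. chi m (u * poly L u))"
    using sum_comp_additive[OF fin T_add, of "\<lambda>u. chi m (u * poly L u)"]
    by (simp add: ker range)
  finally show "r_sum m L = 2 ^ m * (\<Sum>u\<in>K. chi m (u * poly L u))"
    by (simp add: assms(5))
  show "2 ^ m * (\<Sum>u\<in>K. chi m (u * poly L u))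
      = 2 ^ m * (\<Sum>u\<in>K. chi m (\<Sum>i=0..k. \<alpha> i * u ^ (2 ^ a i + 1)))"
    by (simp add: assms(7) poly_linearized_poly sum_distrib_left mult.left_commute)
qed

end
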